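(* Let $P$ be a finite poset. Define a piecewise-linear map $\Phi^{(e)}:\mathbb{R}^P\to\mathbb{R}^P$ (the enriched transfer map) inductively on the ordering of $P$ by $$(\Phi^{(e)}f)(v)=\begin{cases} f(v) & \text{if } v \text{ is minimal in } P,\\ f(v)-\max\left\{\sum_{i=1}^r |(\Phi^{(e)}f)(v_i)| : v>v_1>\dots>v_r \text{ is a chain in } P\right\} & \text{if } v \text{ is not minimal in } P.\end{cases}$$ Then $\Phi^{(e)}$ induces a continuous bijection from the enriched order polytope $\mathcal{O}^{(e)}(P)$ to the enriched chain polytope $\mathcal{C}^{(e)}(P)$. In particular, for any nonnegative integer $m$, $\Phi^{(e)}$ provides a bijection between $m\mathcal{O}^{(e)}(P)\cap\mathbb{Z}^P$ and $m\mathcal{C}^{(e)}(P)\cap\mathbb{Z}^P$.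
   Context: $\mathbb{R}^P$ (resp. $\mathbb{Z}^P$) is the set of real-valued (resp. integer-valued) functions on $P$; $\mathbb{R}^P$ is identified with Euclidean space. For $f\in\mathbb{R}^P$, $\operatorname{supp}(f)=\{v\in P: f(v)\neq 0\}$. An order filter of $P$ is a subset $F\subset P$ such that $v\in F$ and $v<w$ imply $w\in F$. $\mathcal{F}^{(e)}(P)$ is the set of $f\in\mathbb{Z}^P$ such that (i) $f(v)\in\{1,0,-1\}$ for any $v\in P$, (ii) $\operatorname{supp}(f)$ is an order filter of $P$, and (iii) if $f(v)=-1$, then $v$ is minimal in $\operatorname{supp}(f)$. $\mathcal{A}^{(e)}(P)$ is the set of $f\in\mathbb{Z}^P$ such that (i) $f(v)\in\{1,0,-1\}$ for any $v\in P$, and (ii) $\operatorname{supp}(f)$ is an antichain of $P$. The enriched order polytope is $\mathcal{O}^{(e)}(P)=\operatorname{conv}\mathcal{F}^{(e)}(P)$ and the enriched chain polytope is $\mathcal{C}^{(e)}(P)=\operatorname{conv}\mathcal{A}^{(e)}(P)$, where $\operatorname{conv}$ denotes convex hull. For a polytope $\mathcal{P}$, $m\mathcal{P}=\{mf: f\in\mathcal{P}\}$. *)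

theory Defs
  imports "HOL-Analysis.Analysis"
begin

(* The finite poset P is an arbitrary type 'a :: {finite, order}, and the Euclidean space of
   real-valued functions on P is real ^ 'a. *)

definition supp :: "real ^ 'a \<Rightarrow> 'a set" where
  "supp f = {v. f $ v \<noteq> 0}"

definition lattice_points :: "(real ^ 'a) set" where
  "lattice_points = {f. \<forall>v. f $ v \<in> \<int>}"

definition order_filter :: "'a::order set \<Rightarrow> bool" where
  "order_filter F \<longleftrightarrow> (\<forall>v w. v \<in> F \<longrightarrow> v < w \<longrightarrow> w \<in> F)"

definition antichain :: "'a::order set \<Rightarrow> bool" where
  "antichain A \<longleftrightarrow> (\<forall>v\<in>A. \<forall>w\<in>A. \<not> v < w)"

definition minimal_in :: "'a::order set \<Rightarrow> 'a \<Rightarrow> bool" where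
  "minimal_in S v \<longleftrightarrow> v \<in> S \<and> (\<forall>w\<in>S. \<not> w < v)"

definition enriched_filters :: "(real ^ 'a::{finite,order}) set" where
  "enriched_filters = {f \<in> lattice_points.
     (\<forall>v. f $ v \<in> {1, 0, -1}) \<and>
     order_filter (supp f) \<and>
     (\<forall>v. f $ v = -1 \<longrightarrow> minimal_in (supp f) v)}"

definition enriched_antichains :: "(real ^ 'a::{finite,order}) set" where
  "enriched_antichains = {f \<in> lattice_points.
     (\<forall>v. f $ v \<in> {1, 0, -1}) \<and>
     antichain (supp f)}"

definition enriched_order_polytope :: "(real ^ 'a::{finite,order}) set" where
  "enriched_order_polytope = convex hull enriched_filters"

definition enriched_chain_polytope :: "(real ^ 'a::{finite,order}) set" where
  "enriched_chain_polytope = convex hull enriched_antichains"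

definition dilate :: "nat \<Rightarrow> (real ^ 'a) set \<Rightarrow> (real ^ 'a) set" where
  "dilate m S = (\<lambda>f. real m *\<^sub>R f) ` S"

(* The lists [v_1, ..., v_r] with r \<ge> 1 and v > v_1 > ... > v_r. *)
definition chains_below :: "'a::order \<Rightarrow> 'a list set" where
  "chains_below v = {vs. vs \<noteq> [] \<and> sorted_wrt (>) (v # vs)}"

lemma chains_below_less: "vs \<in> chains_below v \<Longrightarrow> w \<in> set vs \<Longrightarrow> w < v"
  by (auto simp: chains_below_def)

lemma finite_chains_below: "finite (chains_below (v :: 'a::{finite,order}))"
proof (rule finite_subset)
  show "chains_below v \<subseteq> {vs. set vs \<subseteq> UNIV \<and> distinct vs}"
  proof
    fix vs assume "vs \<in> chains_below v"
    then have "sorted_wrt (>) vs" by (simp add: chains_below_def)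
    then have "distinct vs" by (induction vs) auto
    then show "vs \<in> {vs. set vs \<subseteq> UNIV \<and> distinct vs}" by simp
  qed
  show "finite {vs :: 'a list. set vs \<subseteq> UNIV \<and> distinct vs}"
    by (rule finite_subset_distinct) simp
qed

lemma chains_below_nonempty: "\<not> minimal_in UNIV v \<Longrightarrow> chains_below v \<noteq> {}"
proof -
  assume "\<not> minimal_in UNIV v"
  then obtain w where "w < v" by (auto simp: minimal_in_def)
  then have "[w] \<in> chains_below v" by (simp add: chains_below_def)
  then show ?thesis by blast
qed

function transfer_coord :: "real ^ 'a::{finite,order} \<Rightarrow> 'a::{finite,order} \<Rightarrow> real" where
  "transfer_coord f v =
     (if minimal_in UNIV v then f $ v
      else f $ v - (MAX vs\<in>chains_below v. \<Sum>w\<leftarrow>vs. \<bar>transfer_coord f w\<bar>))"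
  by auto
termination
  by (relation "Wellfounded.measure (\<lambda>(f, v). card {w. w < v})")
     (auto intro!: psubset_card_mono dest: chains_below_less)

declare transfer_coord.simps [simp del]

definition enriched_transfer :: "real ^ 'a::{finite,order} \<Rightarrow> real ^ 'a::{finite,order}" where
  "enriched_transfer f = (\<chi> v. transfer_coord f v)"

lemma enriched_transfer_eq:
  "enriched_transfer f $ v =
     (if minimal_in UNIV v then f $ v
      else f $ v - Max {\<Sum>w\<leftarrow>vs. \<bar>enriched_transfer f $ w\<bar> | vs.
                          vs \<noteq> [] \<and> sorted_wrt (>) (v # vs)})"
  by (subst enriched_transfer_def)
     (simp add: transfer_coord.simps[of f v] enriched_transfer_def chains_below_def
        setcompr_eq_image del: sorted_wrt.simps)

end

theory Submission
  imports Defs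
begin

text \<open>
  Let \<open>h\<^sub>g(v)\<close> be the maximum of \<open>\<Sum>\<bar>g(v\<^sub>i)\<bar>\<close> over the chains with top element \<open>v\<close>, and write
  \<open>g = \<Phi> f\<close>, so that \<open>f(v) = g(v) + d\<^sub>g(v)\<close> where \<open>d\<^sub>g(v)\<close> is the maximum of \<open>h\<^sub>g(w)\<close> over
  \<open>w < v\<close>. This formula inverts \<open>\<Phi>\<close>, so it is enough to show that the two polytopes are
  \<open>{f. h\<^bsub>\<Phi> f\<^esub> \<le> 1}\<close> and \<open>{g. h\<^sub>g \<le> 1}\<close>. Since
  \<open>h\<^sub>g(v) = \<bar>g(v)\<bar> + d\<^sub>g(v) = max (f(v)) (2 d\<^sub>g(v) - f(v))\<close>, the height is a convex function of
  \<open>f\<close> as well as of \<open>g\<close>; as it is at most 1 at the vertices, both polytopes are contained in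
  these sets. Conversely, if \<open>h\<^sub>g \<le> 1\<close>, pick a threshold \<open>t \<in> [0,1]\<close> uniformly at random. The
  function with values 1 where \<open>t \<le> d\<^sub>g\<close>, \<open>sgn g\<close> where \<open>d\<^sub>g < t \<le> h\<^sub>g\<close> and 0 elsewhere is an
  enriched filter with mean \<open>f\<close>, and its restriction to \<open>{v. d\<^sub>g(v) < t \<le> h\<^sub>g(v)}\<close> is an
  enriched antichain with mean \<open>g\<close>.
\<close>

section \<open>Preliminaries: induction on the order, averages over [0,1]\<close>

lemma less_wf_induct [case_names less]:
  fixes v :: "'a::{finite,order}"
  assumes "\<And>v. (\<And>w. w < v \<Longrightarrow> P w) \<Longrightarrow> P v"
  shows "P v"
proof (induction "card {w. w < v}" arbitrary: v rule: less_induct)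
  case less
  show ?case
  proof (rule assms)
    fix w assume "w < v"
    then have "{x. x < w} \<subset> {x. x < v}" by auto
    then show "P w" by (intro less psubset_card_mono) auto
  qed
qed

lemma continuous_on_Max_image:
  fixes F :: "'i \<Rightarrow> 'b::topological_space \<Rightarrow> 'c::linorder_topology"
  assumes "finite I" "I \<noteq> {}" "\<And>i. i \<in> I \<Longrightarrow> continuous_on S (F i)"
  shows "continuous_on S (\<lambda>x. Max ((\<lambda>i. F i x) ` I))"
  using assms
proof (induction I rule: finite_ne_induct)
  case (insert i I)
  then show ?case by (simp add: continuous_on_max)
qed simp

text \<open>Since [0,1] has length 1, integrating the functional of a hyperplane that separates
  \<open>y\<close> from \<open>S\<close> gives a contradiction. This turns a mean over random
  thresholds into membership in a convex hull.\<close>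

lemma has_integral_mem_closed_convex:
  fixes F :: "real \<Rightarrow> 'b::euclidean_space"
  assumes "convex S" "closed S" "(F has_integral y) {0..1}" "\<And>t. t \<in> {0..1} \<Longrightarrow> F t \<in> S"
  shows "y \<in> S"
proof (rule ccontr)
  assume "y \<notin> S"
  then obtain a b where ab: "a \<bullet> y < b" "\<forall>x\<in>S. a \<bullet> x > b"
    using separating_hyperplane_closed_point assms(1,2) by blast
  have "((\<lambda>t. b) has_integral b) {0..1::real}"
    using has_integral_const_real[of b 0 1] by simp
  moreover have "((\<lambda>t. a \<bullet> F t) has_integral a \<bullet> y) {0..1}"
    using has_integral_linear[OF assms(3) bounded_linear_inner_right, of a] by (simp add: o_def)
  moreover have "b \<le> a \<bullet> F t" if "t \<in> {0..1}" for t
    using ab(2) assms(4)[OF that] by (simp add: less_imp_le)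
  ultimately have "b \<le> a \<bullet> y"
    by (rule has_integral_le)
  then show False using ab(1) by simp
qed

lemma has_integral_vec_componentwise:
  fixes F :: "real \<Rightarrow> real ^ 'a"
  assumes "\<And>v. ((\<lambda>t. F t $ v) has_integral y $ v) S"
  shows "(F has_integral y) S"
proof (rule has_integral_componentwise_iff[THEN iffD2], rule ballI)
  fix b :: "real ^ 'a"
  assume "b \<in> Basis"
  then obtain v where "b = axis v 1" by (auto simp: Basis_vec_def)
  then show "((\<lambda>t. F t \<bullet> b) has_integral y \<bullet> b) S"
    using assms[of v] by (simp add: inner_axis)
qed

lemma has_integral_threshold:
  fixes c :: real
  assumes "0 \<le> c" "c \<le> 1"
  shows "((\<lambda>t. if t \<le> c then a else 0) has_integral c * a) {0..1}"
proof -
  have "((\<lambda>t. a) has_integral c * a) {0..c}"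
    using has_integral_const_real[of a 0 c] assms by simp
  then have "((\<lambda>t. if t \<in> {0..c} then a else 0) has_integral c * a) {0..1}"
    using assms by (subst has_integral_restrict) auto
  then show ?thesis
    by (rule has_integral_eq[rotated]) auto
qed

section \<open>Depth and height\<close>

text \<open>Unlike \<open>chains_below\<close>, the index set contains the empty chain, so the
  maximum exists and equals 0 at minimal elements.\<close>

definition depth :: "real ^ 'a::{finite,order} \<Rightarrow> 'a \<Rightarrow> real" where
  "depth g v = (MAX vs\<in>{vs. sorted_wrt (>) (v # vs)}. \<Sum>w\<leftarrow>vs. \<bar>g $ w\<bar>)"

definition height :: "real ^ 'a::{finite,order} \<Rightarrow> 'a \<Rightarrow> real" where
  "height g v = \<bar>g $ v\<bar> + depth g v"

lemma chains_insert_Nil: "{vs. sorted_wrt (>) (v # vs)} = insert [] (chains_below v)"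
  by (auto simp: chains_below_def)

lemma finite_chains: "finite {vs. sorted_wrt (>) (v # vs)}" for v :: "'a::{finite,order}"
  by (simp only: chains_insert_Nil finite_insert finite_chains_below)

lemma chain_sum_le_depth:
  "sorted_wrt (>) (v # vs) \<Longrightarrow> (\<Sum>w\<leftarrow>vs. \<bar>g $ w\<bar>) \<le> depth g v"
  unfolding depth_def using finite_chains[of v] by (intro Max_ge finite_imageI imageI) auto

lemma depth_attained:
  obtains vs where "sorted_wrt (>) (v # vs)" "depth g v = (\<Sum>w\<leftarrow>vs. \<bar>g $ w\<bar>)"
proof -
  have "depth g v \<in> (\<lambda>vs. \<Sum>w\<leftarrow>vs. \<bar>g $ w\<bar>) ` {vs. sorted_wrt (>) (v # vs)}"
    unfolding depth_def using finite_chains[of v] chains_insert_Nil[of v]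
    by (intro Max_in finite_imageI) blast+
  then show ?thesis using that by auto
qed

lemma depth_nonneg: "0 \<le> depth g v"
  using chain_sum_le_depth[of v "[]" g] by simp

text \<open>Putting \<open>w\<close> on top of an optimal chain below \<open>w\<close> gives a chain
  below \<open>v\<close>. With \<open>depth_le\<close>, this makes \<open>depth g v\<close> the
  least nonnegative upper bound of the heights below \<open>v\<close>.\<close>

lemma height_le_depth:
  assumes "w < v"
  shows "height g w \<le> depth g v"
proof -
  obtain vs where vs: "sorted_wrt (>) (w # vs)" "depth g w = (\<Sum>w\<leftarrow>vs. \<bar>g $ w\<bar>)"
    by (rule depth_attained)
  have "sorted_wrt (>) (v # w # vs)"
    using vs(1) assms by (auto dest: less_trans[OF _ assms])
  from chain_sum_le_depth[OF this, of g] vs(2) show ?thesis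
    by (simp add: height_def)
qed

lemma depth_le:
  assumes "0 \<le> c" "\<And>w. w < v \<Longrightarrow> height g w \<le> c"
  shows "depth g v \<le> c"
proof -
  obtain vs where vs: "sorted_wrt (>) (v # vs)" "depth g v = (\<Sum>w\<leftarrow>vs. \<bar>g $ w\<bar>)"
    by (rule depth_attained)
  show ?thesis
  proof (cases vs)
    case Nil
    then show ?thesis using vs assms(1) by simp
  next
    case (Cons w ws)
    then have "depth g v \<le> height g w"
      using vs chain_sum_le_depth[of w ws g] by (simp add: height_def)
    also have "\<dots> \<le> c" using vs(1) Cons by (intro assms(2)) simp
    finally show ?thesis .
  qed
qed

lemma depth_cong:
  assumes "\<And>w. w < v \<Longrightarrow> g $ w = g' $ w"
  shows "depth g v = depth g' v"
  unfolding depth_def using assms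
  by (intro arg_cong[where f = Max] image_cong refl arg_cong[where f = sum_list] map_cong) auto

lemma depth_scale:
  assumes "0 \<le> c"
  shows "depth (c *\<^sub>R g) v = c * depth g v"
proof -
  have "mono ((*) c)" using assms by (auto intro!: monoI mult_left_mono)
  then have "c * depth g v = Max ((*) c ` (\<lambda>vs. \<Sum>w\<leftarrow>vs. \<bar>g $ w\<bar>) ` {vs. sorted_wrt (>) (v # vs)})"
    unfolding depth_def using finite_chains[of v] chains_insert_Nil[of v]
    by (intro mono_Max_commute finite_imageI) blast+
  then show ?thesis
    using assms by (simp add: depth_def image_image abs_mult sum_list_const_mult del: sorted_wrt.simps)
qed

lemma depth_Ints:
  assumes "\<And>w. w < v \<Longrightarrow> g $ w \<in> \<int>"
  shows "depth g v \<in> \<int>"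
proof -
  obtain vs where vs: "sorted_wrt (>) (v # vs)" "depth g v = (\<Sum>w\<leftarrow>vs. \<bar>g $ w\<bar>)"
    by (rule depth_attained)
  have "(\<Sum>w\<leftarrow>vs. \<bar>g $ w\<bar>) \<in> \<int>" if "set vs \<subseteq> {w. w < v}" for vs
    using that by (induction vs) (auto simp: assms intro!: Ints_add Ints_abs)
  then show ?thesis using vs by auto
qed

lemma continuous_on_depth:
  assumes "\<And>w. w < v \<Longrightarrow> continuous_on S (\<lambda>x. G x $ w)"
  shows "continuous_on S (\<lambda>x. depth (G x) v)"
  unfolding depth_def
proof (intro continuous_on_Max_image finite_chains)
  show "{vs. sorted_wrt (>) (v # vs)} \<noteq> {}" by (simp only: chains_insert_Nil) simp
  fix vs assume "vs \<in> {vs. sorted_wrt (>) (v # vs)}"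
  then have "set vs \<subseteq> {w. w < v}" by auto
  then show "continuous_on S (\<lambda>x. \<Sum>w\<leftarrow>vs. \<bar>G x $ w\<bar>)"
    by (induction vs) (auto intro!: continuous_intros assms)
qed

section \<open>The transfer map and its inverse\<close>

lemma enriched_transfer_nth:
  "enriched_transfer f $ v = f $ v - depth (enriched_transfer f) v"
proof (cases "minimal_in UNIV v")
  case True
  then have "depth (enriched_transfer f) v \<le> 0"
    by (intro depth_le) (auto simp: minimal_in_def)
  then have "depth (enriched_transfer f) v = 0"
    using depth_nonneg by (rule antisym)
  with True show ?thesis by (simp add: enriched_transfer_eq[of f v])
next
  case False
  define A where "A = (\<lambda>vs. \<Sum>w\<leftarrow>vs. \<bar>enriched_transfer f $ w\<bar>) ` chains_below v"
  have A: "finite A" "A \<noteq> {}"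
    using finite_chains_below chains_below_nonempty[OF False] by (auto simp: A_def)
  have "0 \<le> a" if "a \<in> A" for a
    using that unfolding A_def by (auto intro!: sum_list_nonneg)
  \<comment> \<open>The empty chain adds only the value 0 to \<open>A\<close>, so it does not change
    the maximum.\<close>
  then have "0 \<le> Max A" using A by auto
  then have "depth (enriched_transfer f) v = Max A"
    using A by (simp add: depth_def chains_insert_Nil A_def del: sorted_wrt.simps)
  moreover have "{\<Sum>w\<leftarrow>vs. \<bar>enriched_transfer f $ w\<bar> | vs. vs \<noteq> [] \<and> sorted_wrt (>) (v # vs)} = A"
    unfolding A_def chains_below_def by blast
  ultimately show ?thesis
    using False enriched_transfer_eq[of f v] by simp
qed

text \<open>No recursion occurs here: the depth is read off from \<open>g\<close>, which already is
  the transferred function.\<close>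

definition inverse_transfer :: "real ^ 'a::{finite,order} \<Rightarrow> real ^ 'a::{finite,order}" where
  "inverse_transfer g = (\<chi> v. g $ v + depth g v)"

lemma inverse_enriched_transfer [simp]: "inverse_transfer (enriched_transfer f) = f"
  by (simp add: inverse_transfer_def vec_eq_iff enriched_transfer_nth[of f])

lemma enriched_inverse_transfer [simp]: "enriched_transfer (inverse_transfer g) = g"
proof -
  have "enriched_transfer (inverse_transfer g) $ v = g $ v" for v
  proof (induction v rule: less_wf_induct)
    case (less v)
    then have "depth (enriched_transfer (inverse_transfer g)) v = depth g v"
      by (rule depth_cong)
    then show ?case
      by (subst enriched_transfer_nth) (simp add: inverse_transfer_def)
  qed
  then show ?thesis by (simp add: vec_eq_iff)
qed

lemma enriched_transfer_scale:
  assumes "0 \<le> c"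
  shows "enriched_transfer (c *\<^sub>R f) = c *\<^sub>R enriched_transfer f"
proof -
  \<comment> \<open>Homogeneity is immediate for the explicit inverse and is carried over to the
    transfer map.\<close>
  have "c *\<^sub>R f = inverse_transfer (c *\<^sub>R enriched_transfer f)"
    using assms
    by (simp add: inverse_transfer_def vec_eq_iff depth_scale enriched_transfer_nth[of f] algebra_simps)
  then show ?thesis by simp
qed

lemma enriched_transfer_lattice_points_iff:
  "enriched_transfer f \<in> lattice_points \<longleftrightarrow> f \<in> lattice_points"
proof
  assume "enriched_transfer f \<in> lattice_points"
  then have "enriched_transfer f $ v + depth (enriched_transfer f) v \<in> \<int>" for v
    by (intro Ints_add depth_Ints) (auto simp: lattice_points_def)
  then have "f $ v \<in> \<int>" for v
    by (metis enriched_transfer_nth diff_add_cancel)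
  then show "f \<in> lattice_points" by (simp add: lattice_points_def)
next
  assume f: "f \<in> lattice_points"
  have "enriched_transfer f $ v \<in> \<int>" for v
  proof (induction v rule: less_wf_induct)
    case (less v)
    then show ?case
      using f by (subst enriched_transfer_nth) (auto simp: lattice_points_def intro!: Ints_diff depth_Ints)
  qed
  then show "enriched_transfer f \<in> lattice_points" by (simp add: lattice_points_def)
qed

lemma continuous_on_enriched_transfer: "continuous_on S enriched_transfer"
proof -
  have "continuous_on S (\<lambda>f. enriched_transfer f $ v)" for v
  proof (induction v rule: less_wf_induct)
    case (less v)
    have "continuous_on S (\<lambda>f. f $ v - depth (enriched_transfer f) v)"
      by (intro continuous_intros continuous_on_depth less)
    then show ?case by (simp only: enriched_transfer_nth[symmetric])
  qed
  then have "continuous_on S (\<lambda>f. \<chi> v. enriched_transfer f $ v)"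
    by (rule continuous_on_vec_lambda)
  then show ?thesis by simp
qed

text \<open>This is |f - d| + d = max f (2d - f). Here d occurs only with a nonnegative coefficient,
  so convexity in \<open>f\<close> can pass from depths to heights.\<close>

lemma height_enriched_transfer:
  "height (enriched_transfer f) v = max (f $ v) (2 * depth (enriched_transfer f) v - f $ v)"
  by (simp add: height_def enriched_transfer_nth[of f v])

section \<open>Convexity of the height\<close>

lemma convex_height_le: "convex {g. \<forall>v. height g v \<le> c}"
proof (rule convexI)
  fix x y :: "real ^ 'a::{finite,order}" and s t :: real
  assume xy: "x \<in> {g. \<forall>v. height g v \<le> c}" "y \<in> {g. \<forall>v. height g v \<le> c}"
    and st: "0 \<le> s" "0 \<le> t" "s + t = 1"
  \<comment> \<open>The height itself is shown to be convex; the bound by \<open>c\<close> alone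
    would not support the induction.\<close>
  have "height (s *\<^sub>R x + t *\<^sub>R y) v \<le> s * height x v + t * height y v" for v
  proof (induction v rule: less_wf_induct)
    case (less v)
    have "depth (s *\<^sub>R x + t *\<^sub>R y) v \<le> s * depth x v + t * depth y v"
    proof (rule depth_le)
      fix w assume "w < v"
      then have "s * height x w + t * height y w \<le> s * depth x v + t * depth y v"
        using st by (intro add_mono mult_left_mono height_le_depth)
      with less[OF \<open>w < v\<close>]
      show "height (s *\<^sub>R x + t *\<^sub>R y) w \<le> s * depth x v + t * depth y v" by linarith
    qed (use st in \<open>simp add: depth_nonneg\<close>)
    moreover have "\<bar>(s *\<^sub>R x + t *\<^sub>R y) $ v\<bar> \<le> s * \<bar>x $ v\<bar> + t * \<bar>y $ v\<bar>"
      using abs_triangle_ineq[of "s * x $ v" "t * y $ v"] st by (simp add: abs_mult)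
    ultimately show ?case
      by (simp add: height_def algebra_simps)
  qed
  moreover have "s * height x v + t * height y v \<le> c" for v
    using xy st by (intro convex_bound_le) auto
  ultimately show "s *\<^sub>R x + t *\<^sub>R y \<in> {g. \<forall>v. height g v \<le> c}"
    by (simp, meson order_trans)
qed

lemma convex_height_enriched_transfer_le: "convex {f. \<forall>v. height (enriched_transfer f) v \<le> c}"
proof (rule convexI)
  fix x y :: "real ^ 'a::{finite,order}" and s t :: real
  assume xy: "x \<in> {f. \<forall>v. height (enriched_transfer f) v \<le> c}"
      "y \<in> {f. \<forall>v. height (enriched_transfer f) v \<le> c}"
    and st: "0 \<le> s" "0 \<le> t" "s + t = 1"
  let ?z = "s *\<^sub>R x + t *\<^sub>R y"
  let ?d = "\<lambda>f. depth (enriched_transfer f)" and ?h = "\<lambda>f. height (enriched_transfer f)"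
  have "?h ?z v \<le> s * ?h x v + t * ?h y v" for v
  proof (induction v rule: less_wf_induct)
    case (less v)
    have "?d ?z v \<le> s * ?d x v + t * ?d y v"
    proof (rule depth_le)
      fix w assume "w < v"
      then have "s * ?h x w + t * ?h y w \<le> s * ?d x v + t * ?d y v"
        using st by (intro add_mono mult_left_mono height_le_depth)
      with less[OF \<open>w < v\<close>] show "?h ?z w \<le> s * ?d x v + t * ?d y v" by linarith
    qed (use st in \<open>simp add: depth_nonneg\<close>)
    then have "2 * ?d ?z v - ?z $ v \<le> s * (2 * ?d x v - x $ v) + t * (2 * ?d y v - y $ v)"
      by (simp add: algebra_simps)
    also have "\<dots> \<le> s * ?h x v + t * ?h y v"
      using st by (intro add_mono mult_left_mono) (simp_all add: height_enriched_transfer)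
    finally have "2 * ?d ?z v - ?z $ v \<le> s * ?h x v + t * ?h y v" .
    moreover have "?z $ v \<le> s * ?h x v + t * ?h y v"
      using st by (auto simp: height_enriched_transfer intro!: add_mono mult_left_mono)
    ultimately show ?case
      by (simp add: height_enriched_transfer[of ?z v])
  qed
  moreover have "s * ?h x v + t * ?h y v \<le> c" for v
    using xy st by (intro convex_bound_le) auto
  ultimately show "?z \<in> {f. \<forall>v. ?h f v \<le> c}"
    by (simp, meson order_trans)
qed

section \<open>The polytopes as sublevel sets of the height\<close>

lemma height_enriched_antichain_le:
  assumes "g \<in> enriched_antichains"
  shows "height g v \<le> 1"
proof -
  have abs_le: "\<bar>g $ v\<bar> \<le> 1" for v
    using assms by (auto simp: enriched_antichains_def dest!: spec[of _ v])
  have anti: "\<not> v < w" if "v \<in> supp g" "w \<in> supp g" for v w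
    using assms that by (auto simp: enriched_antichains_def antichain_def)
  \<comment> \<open>The sharper bound 0 away from the up-set generated by the support makes the
    depth vanish on the support.\<close>
  have "height g v \<le> (if \<exists>w\<in>supp g. w \<le> v then 1 else 0)" for v
  proof (induction v rule: less_wf_induct)
    case (less v)
    show ?case
    proof (cases "v \<in> supp g")
      case True
      have "depth g v \<le> 0"
      proof (rule depth_le)
        fix w assume "w < v"
        then have "\<not> (\<exists>u\<in>supp g. u \<le> w)"
          using anti True by (meson le_less_trans)
        then show "height g w \<le> 0" using less[OF \<open>w < v\<close>] by auto
      qed simp
      then show ?thesis using True abs_le[of v] by (auto simp: height_def)
    next
      case False
      have "depth g v \<le> (if \<exists>w\<in>supp g. w \<le> v then 1 else 0)"
      proof (rule depth_le)
        fix w assume "w < v"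
        from less[OF this] show "height g w \<le> (if \<exists>w\<in>supp g. w \<le> v then 1 else 0)"
          using \<open>w < v\<close> order_trans[OF _ less_imp_le[OF \<open>w < v\<close>]]
          by (auto split: if_splits)
      qed simp
      then show ?thesis using False by (simp add: height_def supp_def)
    qed
  qed
  then show ?thesis by (rule order_trans) simp
qed

lemma height_enriched_filter_le:
  assumes "f \<in> enriched_filters"
  shows "height (enriched_transfer f) v \<le> 1"
proof -
  have vals: "f $ v \<in> {1, 0, -1}" for v
    using assms by (auto simp: enriched_filters_def)
  have filt: "w \<in> supp f" if "v \<in> supp f" "v < w" for v w
    using assms that by (auto simp: enriched_filters_def order_filter_def)
  have mini: "w \<notin> supp f" if "f $ v = -1" "w < v" for v w
    using assms that by (auto simp: enriched_filters_def minimal_in_def)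
  \<comment> \<open>Strengthened for the induction: the height must vanish outside the
    support.\<close>
  have "height (enriched_transfer f) v \<le> \<bar>f $ v\<bar>" for v
  proof (induction v rule: less_wf_induct)
    case (less v)
    \<comment> \<open>Below a zero of \<open>f\<close> there is no support by the filter property,
      below a value -1 none by minimality.\<close>
    have depth: "depth (enriched_transfer f) v \<le> (if f $ v = 1 then 1 else 0)"
    proof (rule depth_le)
      fix w assume "w < v"
      have "\<bar>f $ w\<bar> \<le> (if f $ v = 1 then 1 else 0)"
        using vals[of v] vals[of w] filt[of w v] mini[of v w] \<open>w < v\<close>
        by (auto simp: supp_def)
      with less[OF \<open>w < v\<close>]
      show "height (enriched_transfer f) w \<le> (if f $ v = 1 then 1 else 0)" by linarith
    qed simp
    then show ?case
      using vals[of v] by (auto simp: height_enriched_transfer)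
  qed
  moreover have "\<bar>f $ v\<bar> \<le> 1" using vals[of v] by auto
  ultimately show ?thesis by (rule order_trans)
qed

text \<open>There are only finitely many sign vectors, so the hull is compact.\<close>

lemma closed_convex_hull_sign_vectors:
  fixes S :: "(real ^ 'a::finite) set"
  assumes "\<And>f v. f \<in> S \<Longrightarrow> f $ v \<in> {1, 0, -1}"
  shows "closed (convex hull S)"
proof -
  have "S \<subseteq> (\<lambda>h. \<chi> v. h v) ` (UNIV \<rightarrow>\<^sub>E {1, 0, -1})"
  proof
    fix f assume "f \<in> S"
    then have "($) f \<in> UNIV \<rightarrow>\<^sub>E {1, 0, -1}" using assms by auto
    then show "f \<in> (\<lambda>h. \<chi> v. h v) ` (UNIV \<rightarrow>\<^sub>E {1, 0, -1})"
      by (rule rev_image_eqI) simp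
  qed
  then have "finite S" by (rule finite_subset) (intro finite_imageI finite_PiE; simp)
  then show ?thesis
    by (intro compact_imp_closed compact_convex_hull finite_imp_compact)
qed

section \<open>Random thresholds: vertices and their means\<close>

definition threshold_antichain :: "real ^ 'a::{finite,order} \<Rightarrow> real \<Rightarrow> real ^ 'a::{finite,order}" where
  "threshold_antichain g t = (\<chi> v. if depth g v < t \<and> t \<le> height g v then sgn (g $ v) else 0)"

definition threshold_filter :: "real ^ 'a::{finite,order} \<Rightarrow> real \<Rightarrow> real ^ 'a::{finite,order}" where
  "threshold_filter g t =
     (\<chi> v. if t \<le> depth g v then 1 else if t \<le> height g v then sgn (g $ v) else 0)"

lemma depth_le_height: "depth g v \<le> height g v"
  by (simp add: height_def)

text \<open>For \<open>v < w\<close> the interval from depth to height at \<open>v\<close> ends no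
  later than the one at \<open>w\<close> begins. Being open on the left, the two are disjoint, so no
  \<open>t\<close> selects both elements.\<close>

lemma threshold_antichain_mem: "threshold_antichain g t \<in> enriched_antichains"
proof -
  have "\<not> v < w" if "v \<in> supp (threshold_antichain g t)" "w \<in> supp (threshold_antichain g t)" for v w
    using that height_le_depth[of v w g]
    by (auto simp: supp_def threshold_antichain_def split: if_splits)
  then show ?thesis
    by (auto simp: enriched_antichains_def lattice_points_def antichain_def
        threshold_antichain_def sgn_real_def)
qed

lemma threshold_filter_mem: "threshold_filter g t \<in> enriched_filters"
proof -
  let ?f = "threshold_filter g t"
  \<comment> \<open>When \<open>t\<close> lies strictly above the depth and not above the height,
    \<open>g $ v\<close> is nonzero and so is its sign.\<close>
  have supp: "v \<in> supp ?f \<longleftrightarrow> t \<le> height g v" for v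
    using depth_le_height[of g v] depth_nonneg[of g v]
    by (auto simp: supp_def threshold_filter_def sgn_real_def height_def)
  have "order_filter (supp ?f)"
    unfolding order_filter_def supp
    using height_le_depth[of _ _ g] depth_le_height[of g] by (meson order_trans)
  moreover have "minimal_in (supp ?f) v" if "?f $ v = -1" for v
  proof -
    \<comment> \<open>A value -1 can only come from the sign branch; then every height below
      \<open>v\<close> is smaller than \<open>t\<close>.\<close>
    have *: "\<not> t \<le> depth g v" "t \<le> height g v"
      using that by (auto simp: threshold_filter_def split: if_splits)
    then show ?thesis
      unfolding minimal_in_def by (auto simp: supp dest!: height_le_depth[of _ v g])
  qed
  ultimately show ?thesis
    by (auto simp: enriched_filters_def lattice_points_def threshold_filter_def sgn_real_def)
qed

lemma threshold_antichain_mean: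
  assumes "\<And>v. height g v \<le> 1"
  shows "(threshold_antichain g has_integral g) {0..1}"
proof (rule has_integral_vec_componentwise)
  fix v
  \<comment> \<open>The indicator of the half-open interval is a difference of two threshold
    functions; its length is \<open>\<bar>g $ v\<bar>\<close>.\<close>
  have "((\<lambda>t. (if t \<le> height g v then sgn (g $ v) else 0) - (if t \<le> depth g v then sgn (g $ v) else 0))
      has_integral height g v * sgn (g $ v) - depth g v * sgn (g $ v)) {0..1}"
    using assms[of v] depth_le_height[of g v] depth_nonneg[of g v]
    by (intro has_integral_diff has_integral_threshold) auto
  moreover have "height g v * sgn (g $ v) - depth g v * sgn (g $ v) = g $ v"
    by (simp add: height_def algebra_simps abs_mult_sgn)
  ultimately show "((\<lambda>t. threshold_antichain g t $ v) has_integral g $ v) {0..1}"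
    using depth_le_height[of g v]
    by (elim has_integral_eq_rhs[OF has_integral_eq, rotated 1])
       (auto simp: threshold_antichain_def)
qed

text \<open>The filter adds to the antichain the indicator of \<open>t \<le> depth g v\<close>,
  whose mean is the depth, exactly the correction made by \<open>inverse_transfer\<close>.\<close>

lemma threshold_filter_mean:
  assumes "\<And>v. height g v \<le> 1"
  shows "(threshold_filter g has_integral inverse_transfer g) {0..1}"
proof (rule has_integral_vec_componentwise)
  fix v
  have "((\<lambda>t. threshold_antichain g t $ v) has_integral g $ v) {0..1}"
    using has_integral_linear[OF threshold_antichain_mean[OF assms] bounded_linear_vec_nth, of v]
    by (simp add: o_def)
  moreover have "((\<lambda>t. if t \<le> depth g v then 1 else 0) has_integral depth g v * 1) {0..1}"
    using assms[of v] depth_le_height[of g v] depth_nonneg[of g v]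
    by (intro has_integral_threshold) auto
  ultimately have "((\<lambda>t. threshold_antichain g t $ v + (if t \<le> depth g v then 1 else 0))
      has_integral g $ v + depth g v * 1) {0..1}"
    by (rule has_integral_add)
  moreover have "threshold_antichain g t $ v + (if t \<le> depth g v then 1 else 0)
      = threshold_filter g t $ v" for t
    by (auto simp: threshold_antichain_def threshold_filter_def)
  ultimately show "((\<lambda>t. threshold_filter g t $ v) has_integral inverse_transfer g $ v) {0..1}"
    by (simp add: inverse_transfer_def)
qed

lemma enriched_chain_polytope_eq: "enriched_chain_polytope = {g. \<forall>v. height g v \<le> 1}"
proof
  show "enriched_chain_polytope \<subseteq> {g. \<forall>v. height g v \<le> 1}"
    unfolding enriched_chain_polytope_def
    by (intro hull_minimal convex_height_le) (auto intro: height_enriched_antichain_le)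
next
  have "g \<in> convex hull enriched_antichains" if "\<And>v. height g v \<le> 1" for g :: "real ^ 'a::{finite,order}"
  proof (rule has_integral_mem_closed_convex[OF convex_convex_hull])
    show "closed (convex hull (enriched_antichains :: (real ^ 'a::{finite,order}) set))"
      by (rule closed_convex_hull_sign_vectors) (auto simp: enriched_antichains_def)
    show "(threshold_antichain g has_integral g) {0..1}"
      using that by (rule threshold_antichain_mean)
  qed (simp add: hull_inc threshold_antichain_mem)
  then show "{g. \<forall>v. height g v \<le> 1} \<subseteq> (enriched_chain_polytope :: (real ^ 'a::{finite,order}) set)"
    by (auto simp: enriched_chain_polytope_def)
qed

lemma enriched_order_polytope_eq:
  "enriched_order_polytope = {f. \<forall>v. height (enriched_transfer f) v \<le> 1}"
proof
  show "enriched_order_polytope \<subseteq> {f. \<forall>v. height (enriched_transfer f) v \<le> 1}"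
    unfolding enriched_order_polytope_def
    by (intro hull_minimal convex_height_enriched_transfer_le) (auto intro: height_enriched_filter_le)
next
  have "f \<in> convex hull enriched_filters"
    if "\<And>v. height (enriched_transfer f) v \<le> 1" for f :: "real ^ 'a::{finite,order}"
  proof (rule has_integral_mem_closed_convex[OF convex_convex_hull])
    show "closed (convex hull (enriched_filters :: (real ^ 'a::{finite,order}) set))"
      by (rule closed_convex_hull_sign_vectors) (auto simp: enriched_filters_def)
    show "(threshold_filter (enriched_transfer f) has_integral f) {0..1}"
      using threshold_filter_mean[of "enriched_transfer f"] that by simp
  qed (simp add: hull_inc threshold_filter_mem)
  then show "{f. \<forall>v. height (enriched_transfer f) v \<le> 1} \<subseteq> (enriched_order_polytope :: (real ^ 'a::{finite,order}) set)"
    by (auto simp: enriched_order_polytope_def)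
qed

section \<open>Bijections between polytopes and between lattice points\<close>

lemma inj_enriched_transfer: "inj enriched_transfer"
  by (rule inj_on_inverseI[where g = inverse_transfer]) simp

lemma enriched_transfer_image:
  "enriched_transfer ` enriched_order_polytope = enriched_chain_polytope"
proof (intro equalityI subsetI)
  fix g :: "real ^ 'a::{finite,order}"
  assume "g \<in> enriched_chain_polytope"
  then have "inverse_transfer g \<in> enriched_order_polytope"
    by (simp add: enriched_chain_polytope_eq enriched_order_polytope_eq)
  then show "g \<in> enriched_transfer ` enriched_order_polytope"
    by (rule rev_image_eqI) simp
qed (auto simp: enriched_chain_polytope_eq enriched_order_polytope_eq)

theorem theorem1p3:
  "continuous_on enriched_order_polytope
     (enriched_transfer :: real ^ 'a::{finite,order} \<Rightarrow> real ^ 'a::{finite,order}) \<and>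
   bij_betw (enriched_transfer :: real ^ 'a::{finite,order} \<Rightarrow> real ^ 'a::{finite,order})
     enriched_order_polytope enriched_chain_polytope \<and>
   (\<forall>m::nat. bij_betw (enriched_transfer :: real ^ 'a::{finite,order} \<Rightarrow> real ^ 'a::{finite,order})
     (dilate m enriched_order_polytope \<inter> lattice_points)
     (dilate m enriched_chain_polytope \<inter> lattice_points))"
proof (intro conjI allI)
  show "continuous_on enriched_order_polytope (enriched_transfer :: real ^ 'a::{finite,order} \<Rightarrow> _)"
    by (rule continuous_on_enriched_transfer)
  show "bij_betw (enriched_transfer :: real ^ 'a::{finite,order} \<Rightarrow> _) enriched_order_polytope enriched_chain_polytope"
    using inj_enriched_transfer enriched_transfer_image
    by (auto simp: bij_betw_def intro: inj_on_subset)
  fix m :: nat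
  \<comment> \<open>Homogeneity for factors \<open>\<ge> 0\<close> covers every \<open>m\<close>,
    including \<open>m = 0\<close>.\<close>
  have image: "enriched_transfer ` dilate m enriched_order_polytope
      = dilate m (enriched_chain_polytope :: (real ^ 'a::{finite,order}) set)"
    by (simp add: dilate_def image_image enriched_transfer_scale flip: enriched_transfer_image)
  \<comment> \<open>Integrality is preserved in both directions, so the image of the intersection is
    the intersection with the lattice.\<close>
  have "enriched_transfer ` (dilate m enriched_order_polytope \<inter> lattice_points)
      = dilate m (enriched_chain_polytope :: (real ^ 'a::{finite,order}) set) \<inter> lattice_points"
    by (auto simp: enriched_transfer_lattice_points_iff simp flip: image)
  then show "bij_betw (enriched_transfer :: real ^ 'a::{finite,order} \<Rightarrow> _)
     (dilate m enriched_order_polytope \<inter> lattice_points)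
     (dilate m enriched_chain_polytope \<inter> lattice_points)"
    using inj_enriched_transfer by (auto simp: bij_betw_def intro: inj_on_subset)
qed

end
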